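(* Let $n\ge 2$, $k\in\{1,\dots,n-1\}$ and $r:=\binom{n}{k}$. Suppose that $A\in\mathbb{R}^{n\times n}$ is DT $k$-diagonally stable. Consider the discrete-time nonlinear system $$x(j+1)=A\phi(x(j)),\qquad j=0,1,2,\dots,$$ with state-space $\mathbb{S}^n$ (so $A\phi(\mathbb{S}^n)\subseteq\mathbb{S}^n$), where $\mathbb{S}\subseteq\mathbb{R}$ with $0$ in the interior of $\mathbb{S}$, and $\phi(x)=[\phi_1(x_1)\ \cdots\ \phi_n(x_n)]^T$ is $k$-content preserving on $\mathbb{S}^n$. For $a\in\mathbb{S}^n$ let $x(j,a)$ denote the solution at time $j$ with $x(0)=a$. For $a^1,\dots,a^k\in\mathbb{S}^n$ let $$y(j)=y(j;a^1,\dots,a^k):=x(j,a^1)\wedge\cdots\wedge x(j,a^k)\in\mathbb{R}^r .$$ Then $$y(j+1)=A^{(k)}\bigl(\phi(x(j,a^1))\wedge\cdots\wedge\phi(x(j,a^k))\bigr)\quad\text{for all } j\ge 0,$$ and this nonlinear dynamical system is diagonally stable, that is, there exists a diagonal matrix $D\in\mathbb{R}^{r\times r}$ with positive diagonal entries such that $V(z):=z^TDz$ satisfies, for all $a^1,\dots,a^k\in\mathbb{S}^n$ and all $j\ge 0$, $V(y(j+1))-V(y(j))\le 0$, with equality only when $y(j)=0$.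
   Context: For an $n\times m$ real matrix $M$ and $k\le\min(n,m)$, the $k$th multiplicative compound $M^{(k)}$ is the $\binom{n}{k}\times\binom{m}{k}$ matrix whose entries are all the $k\times k$ minors of $M$, with rows and columns indexed by the $k$-element subsets (increasing sequences) of the row and column indices in lexicographic order. The wedge product of $k$ vectors $a^1,\dots,a^k\in\mathbb{R}^n$ is the column vector $a^1\wedge\cdots\wedge a^k:=[a^1\ \cdots\ a^k]^{(k)}\in\mathbb{R}^{\binom{n}{k}}$. For symmetric matrices, $P\prec Q$ means that $Q-P$ is positive-definite. $A\in\mathbb{R}^{n\times n}$ is called DT $k$-diagonally stable if there exists a diagonal matrix $D\in\mathbb{R}^{r\times r}$, $r=\binom{n}{k}$, with positive diagonal entries such that $(A^{(k)})^TDA^{(k)}\prec D$. $k$-content preserving: let $\mathbb{S}\subseteq\mathbb{R}$ with $0\in\operatorname{int}\mathbb{S}$, and let $\phi:\mathbb{S}^n\to\mathbb{R}^n$, $\phi(x)=[\phi_1(x_1)\ \cdots\ \phi_n(x_n)]^T$, where every $\phi_i:\mathbb{S}\to\mathbb{R}$ is a continuous scalar function such that $\phi_i(s)=0$ holds only for $s=0$. The map $\phi$ is called $k$-content preserving on $\mathbb{S}^n$ if for any $a^1,\dots,a^k\in\mathbb{S}^n$, with $q:=\phi(a^1)\wedge\cdots\wedge\phi(a^k)$ and $p:=a^1\wedge\cdots\wedge a^k$, we have for all $i=1,\dots,r$: $q_i=0$ if $p_i=0$, and $0<|q_i|\le|p_i|$ if $p_i\ne 0$. *)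

theory Defs
  imports
    "Jordan_Normal_Form.Determinant"
    "Jordan_Normal_Form.DL_Submatrix"
    "HOL-Library.List_Lexorder"
    "HOL-Analysis.Elementary_Topology"
begin

(* The k-element subsets of {0..<n} as strictly increasing lists. The linear order on lists
   used by sorted_list_of_set is the lexicographic order of List_Lexorder. *)
definition k_subsets :: "nat \<Rightarrow> nat \<Rightarrow> nat list list" where
  "k_subsets n k =
     sorted_list_of_set {xs. length xs = k \<and> set xs \<subseteq> {0..<n} \<and> sorted_wrt (<) xs}"

lemma set_k_subsets:
  "set (k_subsets n k) = {xs. length xs = k \<and> set xs \<subseteq> {0..<n} \<and> sorted_wrt (<) xs}"
proof -
  have "finite {xs. set xs \<subseteq> {0..<n} \<and> length xs = k}"
    by (rule finite_lists_length_eq) simp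
  then have "finite {xs. length xs = k \<and> set xs \<subseteq> {0..<n} \<and> sorted_wrt (<) xs}"
    by (rule rev_finite_subset) blast
  then show ?thesis
    unfolding k_subsets_def by (rule set_sorted_list_of_set)
qed

lemma sorted_k_subsets: "sorted_wrt (<) (k_subsets n k)"
  unfolding k_subsets_def by (rule strict_sorted_list_of_set)

lemma length_k_subsets: "length (k_subsets n k) = n choose k"
proof -
  let ?L = "{xs. length xs = k \<and> set xs \<subseteq> {0..<n} \<and> sorted_wrt (<) xs}"
  have "bij_betw set ?L {K. K \<subseteq> {0..<n} \<and> card K = k}"
  proof (rule bij_betwI[where g = sorted_list_of_set])
    show "set \<in> ?L \<rightarrow> {K. K \<subseteq> {0..<n} \<and> card K = k}"
      by (auto simp: strict_sorted_iff distinct_card)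
    show "sorted_list_of_set \<in> {K. K \<subseteq> {0..<n} \<and> card K = k} \<rightarrow> ?L"
    proof
      fix K assume K: "K \<in> {K. K \<subseteq> {0..<n} \<and> card K = k}"
      then have "finite K" by (auto dest: finite_subset)
      then show "sorted_list_of_set K \<in> ?L" using K by auto
    qed
    show "sorted_list_of_set (set xs) = xs" if "xs \<in> ?L" for xs
      using that by (simp add: sorted_list_of_set.idem_if_sorted_distinct strict_sorted_iff)
    show "set (sorted_list_of_set K) = K" if "K \<in> {K. K \<subseteq> {0..<n} \<and> card K = k}" for K
      using that finite_subset[of K "{0..<n}"] by simp
  qed
  then have "card ?L = card {K. K \<subseteq> {0..<n} \<and> card K = k}"
    by (rule bij_betw_same_card)
  also have "\<dots> = n choose k"
    using n_subsets[of "{0..<n}" k] by simp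
  finally show ?thesis
    unfolding k_subsets_def by simp
qed

definition compound :: "nat \<Rightarrow> 'a :: comm_ring_1 mat \<Rightarrow> 'a mat" where
  "compound k M =
     mat (dim_row M choose k) (dim_col M choose k)
       (\<lambda>(i, j). det (submatrix M (set (k_subsets (dim_row M) k ! i))
                                  (set (k_subsets (dim_col M) k ! j))))"

(* The compound of order k of an n x k matrix has exactly one column. *)
definition wedge :: "nat \<Rightarrow> 'a :: comm_ring_1 vec list \<Rightarrow> 'a vec" where
  "wedge n as = col (compound (length as) (mat_of_cols n as)) 0"

definition pos_def_mat :: "real mat \<Rightarrow> bool" where
  "pos_def_mat M \<longleftrightarrow> square_mat M \<and> transpose_mat M = M \<and>
     (\<forall>x \<in> carrier_vec (dim_row M). x \<noteq> 0\<^sub>v (dim_row M) \<longrightarrow> x \<bullet> (M *\<^sub>v x) > 0)"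

definition pos_diag_mat :: "nat \<Rightarrow> real mat \<Rightarrow> bool" where
  "pos_diag_mat r D \<longleftrightarrow> D \<in> carrier_mat r r \<and> diagonal_mat D \<and> (\<forall>i < r. D $$ (i, i) > 0)"

definition DT_k_diagonally_stable :: "nat \<Rightarrow> nat \<Rightarrow> real mat \<Rightarrow> bool" where
  "DT_k_diagonally_stable n k A \<longleftrightarrow>
     (\<exists>D. pos_diag_mat (n choose k) D \<and>
          pos_def_mat (D - transpose_mat (compound k A) * D * compound k A))"

definition vec_cube :: "nat \<Rightarrow> 'a set \<Rightarrow> 'a vec set" where
  "vec_cube n S = {x \<in> carrier_vec n. \<forall>i < n. x $ i \<in> S}"

definition diag_map :: "(nat \<Rightarrow> 'a \<Rightarrow> 'b) \<Rightarrow> 'a vec \<Rightarrow> 'b vec" where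
  "diag_map \<phi> x = vec (dim_vec x) (\<lambda>i. \<phi> i (x $ i))"

definition k_content_preserving :: "nat \<Rightarrow> nat \<Rightarrow> real set \<Rightarrow> (nat \<Rightarrow> real \<Rightarrow> real) \<Rightarrow> bool" where
  "k_content_preserving n k S \<phi> \<longleftrightarrow>
     (\<forall>as. length as = k \<and> set as \<subseteq> vec_cube n S \<longrightarrow>
       (let q = wedge n (map (diag_map \<phi>) as); p = wedge n as in
         \<forall>i < n choose k.
           (p $ i = 0 \<longrightarrow> q $ i = 0) \<and>
           (p $ i \<noteq> 0 \<longrightarrow> 0 < \<bar>q $ i\<bar> \<and> \<bar>q $ i\<bar> \<le> \<bar>p $ i\<bar>)))"

primrec solution :: "real mat \<Rightarrow> (nat \<Rightarrow> real \<Rightarrow> real) \<Rightarrow> nat \<Rightarrow> real vec \<Rightarrow> real vec" where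
  "solution A \<phi> 0 a = a"
| "solution A \<phi> (Suc j) a = A *\<^sub>v diag_map \<phi> (solution A \<phi> j a)"

definition wedge_solution ::
    "nat \<Rightarrow> real mat \<Rightarrow> (nat \<Rightarrow> real \<Rightarrow> real) \<Rightarrow> real vec list \<Rightarrow> nat \<Rightarrow> real vec" where
  "wedge_solution n A \<phi> as j = wedge n (map (solution A \<phi> j) as)"

definition quad_form :: "real mat \<Rightarrow> real vec \<Rightarrow> real" where
  "quad_form D z = z \<bullet> (D *\<^sub>v z)"

end

theory Submission
  imports Defs
begin

text \<open>
  By the Cauchy--Binet formula the compound is multiplicative, so
  \<open>y (j + 1) = compound k A *\<^sub>v q\<close>, where \<open>q\<close> is the wedge of the vectors
  \<open>\<phi> (x (j, a))\<close>. For the \<open>D\<close> given by diagonal stability,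
  \<open>V (y (j + 1)) < V q\<close> unless \<open>q = 0\<close>. Since \<open>D\<close> is diagonal and positive and \<open>\<phi>\<close>
  preserves \<open>k\<close>-content, \<open>V q \<le> V (y j)\<close>, and \<open>q = 0\<close> only if \<open>y j = 0\<close>.
\<close>

section \<open>Submatrices indexed by increasing lists\<close>

text \<open>\<open>pick\<close> finds an element by the number of smaller elements in the set; in a
  strictly increasing list exactly the first \<open>i\<close> entries lie below
  \<open>xs ! i\<close>.\<close>

lemma pick_set_sorted:
  assumes "sorted_wrt (<) xs" "i < length xs"
  shows "pick (set xs) i = xs ! i"
proof -
  have "{a \<in> set xs. a < xs ! i} = (!) xs ` {0..<i}"
  proof (intro equalityI subsetI)
    fix a assume "a \<in> {a \<in> set xs. a < xs ! i}"
    then obtain j where j: "j < length xs" "a = xs ! j" "xs ! j < xs ! i"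
      by (auto simp: in_set_conv_nth)
    moreover have "\<not> i < j" "i \<noteq> j"
      using sorted_wrt_nth_less[OF assms(1), of i j] j by auto
    ultimately show "a \<in> (!) xs ` {0..<i}" by auto
  next
    fix a assume "a \<in> (!) xs ` {0..<i}"
    then show "a \<in> {a \<in> set xs. a < xs ! i}"
      using sorted_wrt_nth_less[OF assms(1), of _ i] assms(2) by auto
  qed
  moreover have "inj_on ((!) xs) {0..<i}"
    using assms by (intro inj_on_nth) (auto simp: strict_sorted_iff)
  ultimately have "card {a \<in> set xs. a < xs ! i} = i"
    by (simp add: card_image)
  then show ?thesis
    using pick_card_in_set[of "xs ! i" "set xs"] assms(2) by simp
qed

text \<open>Trades the set-indexed \<open>submatrix\<close> for list indexing, the form in which
  minors enter the Cauchy-Binet formula.\<close>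

lemma submatrix_sorted_lists:
  assumes "sorted_wrt (<) xs" "set xs \<subseteq> {0..<dim_row M}"
    and "sorted_wrt (<) ys" "set ys \<subseteq> {0..<dim_col M}"
  shows "submatrix M (set xs) (set ys) =
    mat (length xs) (length ys) (\<lambda>(i, j). M $$ (xs ! i, ys ! j))"
proof -
  have "{i. i < dim_row M \<and> i \<in> set xs} = set xs" "{j. j < dim_col M \<and> j \<in> set ys} = set ys"
    using assms by auto
  moreover have "card (set xs) = length xs" "card (set ys) = length ys"
    using assms by (auto simp: strict_sorted_iff distinct_card)
  ultimately show ?thesis
    unfolding submatrix_def using assms
    by (intro eq_matI) (auto simp: pick_set_sorted)
qed

section \<open>The Cauchy-Binet formula\<close>

text \<open>An injective map on \<open>{0..<k}\<close> amounts to its range, listed increasingly as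
  \<open>xs\<close>, together with the order \<open>p\<close> in which the range is visited. The
  \<open>restrict\<close> makes the map extensional, as membership in the function space
  demands.\<close>

lemma bij_betw_sorted_permutes_inj_PiE:
  "bij_betw (\<lambda>(xs, p). restrict (\<lambda>i. xs ! p i) {0..<k})
     (set (k_subsets n k) \<times> {p. p permutes {0..<k}})
     {f \<in> {0..<k} \<rightarrow>\<^sub>E {0..<n}. inj_on f {0..<k}}"
  (is "bij_betw ?h ?L ?R")
proof (rule bij_betw_imageI)
  have im: "restrict (\<lambda>i. xs ! p i) {0..<k} ` {0..<k} = set xs"
    if "length xs = k" "p permutes {0..<k}" for xs :: "nat list" and p
  proof -
    have "restrict (\<lambda>i. xs ! p i) {0..<k} ` {0..<k} = (!) xs ` p ` {0..<k}"
      by (auto simp: image_image)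
    then show ?thesis
      using that by (auto simp: permutes_image set_conv_nth)
  qed
  show "inj_on ?h ?L"
  proof (rule inj_onI, clarify)
    fix xs p ys q
    assume xs: "xs \<in> set (k_subsets n k)" and p: "p permutes {0..<k}"
      and ys: "ys \<in> set (k_subsets n k)" and q: "q permutes {0..<k}"
      and eq: "restrict (\<lambda>i. xs ! p i) {0..<k} = restrict (\<lambda>i. ys ! q i) {0..<k}"
    \<comment> \<open>The image of the common map recovers the range, and a strictly increasing list
      is determined by its set.\<close>
    have "set xs = set ys"
      using im[of xs p] im[of ys q] xs ys p q eq by (simp add: set_k_subsets)
    then have xy: "xs = ys"
      using xs ys by (auto simp: set_k_subsets intro: strict_sorted_equal)
    have "p i = q i" for i
    proof (cases "i < k")
      case True
      then have "xs ! p i = xs ! q i"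
        using fun_cong[OF eq, of i] xy by simp
      moreover have "p i < k" "q i < k"
        using permutes_in_image[OF p, of i] permutes_in_image[OF q, of i] True by auto
      ultimately show ?thesis
        using xs by (auto simp: set_k_subsets strict_sorted_iff nth_eq_iff_index_eq)
    next
      case False
      then show ?thesis using permutes_not_in[OF p] permutes_not_in[OF q] by simp
    qed
    then show "xs = ys \<and> p = q" using xy by auto
  qed
  show "?h ` ?L = ?R"
  proof (intro equalityI subsetI)
    fix f assume "f \<in> ?h ` ?L"
    then obtain xs p where f: "f = restrict (\<lambda>i. xs ! p i) {0..<k}"
      and xs: "length xs = k" "set xs \<subseteq> {0..<n}" "distinct xs" and p: "p permutes {0..<k}"
      by (auto simp: set_k_subsets strict_sorted_iff)
    have "f ` {0..<k} = set xs" using im xs p f by simp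
    \<comment> \<open>The image has \<open>k\<close> elements, as many as the domain.\<close>
    moreover from this have "inj_on f {0..<k}"
      using xs by (intro eq_card_imp_inj_on) (simp_all add: distinct_card)
    moreover have "f \<in> extensional {0..<k}" using f by simp
    ultimately show "f \<in> ?R" using xs by (auto simp: PiE_def)
  next
    fix f assume f: "f \<in> ?R"
    define xs where "xs = sorted_list_of_set (f ` {0..<k})"
    have set_xs: "set xs = f ` {0..<k}" by (simp add: xs_def)
    have len: "length xs = k" using f by (simp add: xs_def card_image)
    have srt: "sorted_wrt (<) xs" by (simp add: xs_def)
    have xs: "xs \<in> set (k_subsets n k)"
      using f set_xs len srt by (auto simp: set_k_subsets)
    have bx: "bij_betw ((!) xs) {0..<k} (f ` {0..<k})"
      using set_xs len srt by (intro bij_betw_nth) (auto simp: strict_sorted_iff atLeast0LessThan)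
    \<comment> \<open>\<open>g i\<close> is the position of \<open>f i\<close> in \<open>xs\<close>;
      \<open>p\<close> extends it by the identity, since \<open>permutes\<close> requires fixed
      points outside \<open>{0..<k}\<close>.\<close>
    define g where "g = inv_into {0..<k} ((!) xs) \<circ> f"
    have bg: "bij_betw g {0..<k} {0..<k}"
      unfolding g_def using f bij_betw_inv_into[OF bx]
      by (intro bij_betw_trans[of f _ "f ` {0..<k}"]) (auto simp: bij_betw_def)
    define p where "p = (\<lambda>i. if i < k then g i else i)"
    have "p permutes {0..<k}"
    proof (rule bij_imp_permutes)
      show "bij_betw p {0..<k} {0..<k}"
        using bg by (rule bij_betw_cong[THEN iffD1, rotated]) (simp add: p_def)
    qed (simp add: p_def)
    moreover have "f = restrict (\<lambda>i. xs ! p i) {0..<k}"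
    proof
      fix i show "f i = restrict (\<lambda>i. xs ! p i) {0..<k} i"
        using f bij_betw_inv_into_right[OF bx, of "f i"]
        by (cases "i < k") (auto simp: p_def g_def PiE_def extensional_def)
    qed
    ultimately show "f \<in> ?h ` ?L" using xs by force
  qed
qed

text \<open>
  Expanding the left-hand determinant gives a sum over maps \<open>f\<close> from \<open>{0..<k}\<close> to \<open>{0..<n}\<close>;
  the non-injective ones produce equal rows, and an injective one is an increasing list
  composed with a permutation.
\<close>

lemma Cauchy_Binet:
  fixes a b :: "nat \<Rightarrow> nat \<Rightarrow> 'a :: comm_ring_1"
  shows "det (mat k k (\<lambda>(i, j). \<Sum>l<n. a i l * b l j)) =
    (\<Sum>xs\<in>set (k_subsets n k).
      det (mat k k (\<lambda>(i, j). a i (xs ! j))) * det (mat k k (\<lambda>(i, j). b (xs ! i) j)))"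
proof -
  let ?P = "{p. p permutes {0..<k}}" and ?F = "{0..<k} \<rightarrow>\<^sub>E {0..<n}"
  let ?t = "\<lambda>f. (\<Prod>i=0..<k. a i (f i)) * det (mat k k (\<lambda>(i, j). b (f i) j))"
  have permlt: "p i < k" if "p permutes {0..<k}" "i < k" for p i
    using permutes_in_image[OF that(1), of i] that(2) by simp
  have "det (mat k k (\<lambda>(i, j). \<Sum>l<n. a i l * b l j)) =
      (\<Sum>p\<in>?P. signof p * (\<Prod>i=0..<k. \<Sum>l\<in>{0..<n}. a i l * b l (p i)))"
    by (subst det_def'[of _ k])
       (auto intro!: sum.cong prod.cong simp: permlt atLeast0LessThan)
  \<comment> \<open>Multiplying out the product of sums chooses one summation index
    \<open>f i\<close> for each row \<open>i\<close>.\<close>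
  also have "\<dots> = (\<Sum>p\<in>?P. \<Sum>f\<in>?F. signof p * (\<Prod>i=0..<k. a i (f i) * b (f i) (p i)))"
    by (simp add: prod_sum_PiE sum_distrib_left)
  also have "\<dots> = (\<Sum>f\<in>?F. \<Sum>p\<in>?P. signof p * (\<Prod>i=0..<k. a i (f i) * b (f i) (p i)))"
    by (rule sum.swap)
  \<comment> \<open>For fixed \<open>f\<close> the factors of \<open>a\<close> do not depend on
    \<open>p\<close>, and the rest is the Leibniz formula for the rows
    \<open>b (f i)\<close>.\<close>
  also have "\<dots> = (\<Sum>f\<in>?F. ?t f)"
    by (subst det_def'[of _ k])
       (auto intro!: sum.cong prod.cong simp: permlt sum_distrib_left prod.distrib mult_ac)
  also have "\<dots> = (\<Sum>f\<in>{f \<in> ?F. inj_on f {0..<k}}. ?t f)"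
  proof (rule sum.mono_neutral_right)
    show "\<forall>f\<in>?F - {f \<in> ?F. inj_on f {0..<k}}. ?t f = 0"
    proof
      fix f assume "f \<in> ?F - {f \<in> ?F. inj_on f {0..<k}}"
      then obtain i j where "i < k" "j < k" "i \<noteq> j" "f i = f j"
        by (auto simp: inj_on_def)
      then have "det (mat k k (\<lambda>(i, j). b (f i) j)) = 0"
        by (intro det_identical_rows[of _ k i j]) auto
      then show "?t f = 0" by simp
    qed
  qed (auto intro: finite_PiE)
  also have "\<dots> = (\<Sum>(xs, p)\<in>set (k_subsets n k) \<times> ?P. ?t (restrict (\<lambda>i. xs ! p i) {0..<k}))"
    by (subst sum.reindex_bij_betw[OF bij_betw_sorted_permutes_inj_PiE, symmetric])
       (simp add: case_prod_unfold)
  also have "\<dots> = (\<Sum>xs\<in>set (k_subsets n k). \<Sum>p\<in>?P. ?t (restrict (\<lambda>i. xs ! p i) {0..<k}))"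
    by (rule sum.cartesian_product[symmetric])
  also have "\<dots> = (\<Sum>xs\<in>set (k_subsets n k).
      det (mat k k (\<lambda>(i, j). a i (xs ! j))) * det (mat k k (\<lambda>(i, j). b (xs ! i) j)))"
  proof (rule sum.cong[OF refl])
    fix xs
    let ?B = "mat k k (\<lambda>(i, j). b (xs ! i) j)"
    have "?t (restrict (\<lambda>i. xs ! p i) {0..<k}) =
        signof p * (\<Prod>i=0..<k. a i (xs ! p i)) * det ?B" if p: "p permutes {0..<k}" for p
    proof -
      \<comment> \<open>These are the rows of \<open>?B\<close> permuted by \<open>p\<close>. The
        resulting factor \<open>signof p\<close> is the sign that the Leibniz expansion of the minor
        of \<open>a\<close> needs.\<close>
      have "mat k k (\<lambda>(i, j). b (restrict (\<lambda>i. xs ! p i) {0..<k} i) j) =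
          mat k k (\<lambda>(i, j). ?B $$ (p i, j))"
        by (rule eq_matI) (auto simp: permlt[OF p])
      then show ?thesis
        using det_permute_rows[of ?B k p] p by simp
    qed
    then have "(\<Sum>p\<in>?P. ?t (restrict (\<lambda>i. xs ! p i) {0..<k})) =
        (\<Sum>p\<in>?P. signof p * (\<Prod>i=0..<k. a i (xs ! p i))) * det ?B"
      by (simp add: sum_distrib_right)
    also have "(\<Sum>p\<in>?P. signof p * (\<Prod>i=0..<k. a i (xs ! p i))) =
        det (mat k k (\<lambda>(i, j). a i (xs ! j)))"
      by (subst det_def'[of _ k]) (auto intro!: sum.cong prod.cong simp: permlt)
    finally show "(\<Sum>p\<in>?P. ?t (restrict (\<lambda>i. xs ! p i) {0..<k})) =
        det (mat k k (\<lambda>(i, j). a i (xs ! j))) * det ?B" .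
  qed
  finally show ?thesis .
qed

section \<open>Multiplicativity of the compound and its action on wedge products\<close>

lemma k_subsets_nthD:
  assumes "i < n choose k"
  shows "length (k_subsets n k ! i) = k" "set (k_subsets n k ! i) \<subseteq> {0..<n}"
    "sorted_wrt (<) (k_subsets n k ! i)"
  using nth_mem[of i "k_subsets n k"] assms by (auto simp: length_k_subsets set_k_subsets)

lemma compound_index:
  assumes "i < dim_row M choose k" "j < dim_col M choose k"
  shows "compound k M $$ (i, j) =
    det (mat k k (\<lambda>(s, t). M $$ (k_subsets (dim_row M) k ! i ! s, k_subsets (dim_col M) k ! j ! t)))"
  using assms k_subsets_nthD[OF assms(1)] k_subsets_nthD[OF assms(2)]
  by (simp add: compound_def submatrix_sorted_lists)

text \<open>Each entry is a minor of \<open>A * B\<close>, which Cauchy-Binet expands over the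
  \<open>k\<close>-subsets of the inner index set; that expansion is the row-by-column product of
  the compounds.\<close>

lemma compound_mult:
  fixes A B :: "'a :: comm_ring_1 mat"
  assumes A: "A \<in> carrier_mat m n" and B: "B \<in> carrier_mat n q"
  shows "compound k (A * B) = compound k A * compound k B"
proof (rule eq_matI)
  fix i j
  assume "i < dim_row (compound k A * compound k B)" "j < dim_col (compound k A * compound k B)"
  then have ij: "i < m choose k" "j < q choose k" using A B by (auto simp: compound_def)
  let ?I = "k_subsets m k ! i" and ?J = "k_subsets q k ! j"
  have lt: "?I ! s < m" "?J ! s < q" if "s < k" for s
    using subsetD[OF k_subsets_nthD(2)[OF ij(1)], of "?I ! s"]
      subsetD[OF k_subsets_nthD(2)[OF ij(2)], of "?J ! s"] that
    by (simp_all add: k_subsets_nthD(1)[OF ij(1)] k_subsets_nthD(1)[OF ij(2)])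
  have "compound k (A * B) $$ (i, j) =
      det (mat k k (\<lambda>(s, t). \<Sum>l<n. A $$ (?I ! s, l) * B $$ (l, ?J ! t)))"
    using A B ij lt
    by (simp add: compound_index)
       (intro arg_cong[of _ _ det] eq_matI, auto simp: scalar_prod_def atLeast0LessThan)
  also have "\<dots> = (\<Sum>xs\<in>set (k_subsets n k). det (mat k k (\<lambda>(s, t). A $$ (?I ! s, xs ! t))) *
      det (mat k k (\<lambda>(s, t). B $$ (xs ! s, ?J ! t))))"
    by (rule Cauchy_Binet)
  also have "\<dots> = (\<Sum>l<n choose k.
      det (mat k k (\<lambda>(s, t). A $$ (?I ! s, k_subsets n k ! l ! t))) *
      det (mat k k (\<lambda>(s, t). B $$ (k_subsets n k ! l ! s, ?J ! t))))"
    \<comment> \<open>Strict sortedness rules out repetitions, so positions in the list reindex the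
      sum over its set.\<close>
    using sorted_k_subsets[of n k]
    by (intro sum.reindex_bij_betw[symmetric] bij_betw_nth)
       (auto simp: length_k_subsets strict_sorted_iff)
  also have "\<dots> = (\<Sum>l<n choose k. compound k A $$ (i, l) * compound k B $$ (l, j))"
    using A B ij by (simp add: compound_index)
  also have "\<dots> = (compound k A * compound k B) $$ (i, j)"
    using A B ij by (simp add: scalar_prod_def compound_def atLeast0LessThan)
  finally show "compound k (A * B) $$ (i, j) = (compound k A * compound k B) $$ (i, j)" .
qed (use A B in \<open>auto simp: compound_def\<close>)

text \<open>Applying \<open>A\<close> to every vector multiplies the matrix of columns by
  \<open>A\<close> on the left, so multiplicativity of the compound carries over to its single
  column.\<close>

lemma wedge_mult_mat_vec:
  fixes A :: "'a :: comm_ring_1 mat"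
  assumes A: "A \<in> carrier_mat n n" and as: "set as \<subseteq> carrier_vec n"
  shows "wedge n (map (\<lambda>a. A *\<^sub>v a) as) = compound (length as) A *\<^sub>v wedge n as"
proof -
  have "mat_of_cols n (map (\<lambda>a. A *\<^sub>v a) as) = A * mat_of_cols n as"
    using A as by (intro mat_col_eqI) (auto simp: subset_iff)
  moreover have "compound (length as) (A * mat_of_cols n as) =
      compound (length as) A * compound (length as) (mat_of_cols n as)"
    using A by (intro compound_mult) auto
  \<comment> \<open>Column \<open>0\<close> exists because \<open>length as choose length as\<close>
    is \<open>1\<close>.\<close>
  moreover have "col (compound (length as) A * compound (length as) (mat_of_cols n as)) 0 =
      compound (length as) A *\<^sub>v col (compound (length as) (mat_of_cols n as)) 0"
    using A by (intro col_mult2) (auto simp: compound_def)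
  ultimately show ?thesis
    by (simp only: wedge_def length_map)
qed

lemma wedge_carrier [simp]: "wedge n as \<in> carrier_vec (n choose length as)"
  by (rule carrier_vecI) (simp add: wedge_def compound_def)

section \<open>Quadratic forms of diagonal and positive-definite matrices\<close>

lemma quad_form_diag:
  assumes D: "D \<in> carrier_mat r r" "diagonal_mat D" and z: "z \<in> carrier_vec r"
  shows "quad_form D z = (\<Sum>i<r. D $$ (i, i) * (z $ i)\<^sup>2)"
proof -
  have "(D *\<^sub>v z) $ i = D $$ (i, i) * z $ i" if "i < r" for i
  proof -
    have "(D *\<^sub>v z) $ i = (\<Sum>j<r. D $$ (i, j) * z $ j)"
      using D z that by (simp add: scalar_prod_def atLeast0LessThan)
    also have "\<dots> = (\<Sum>j\<in>{i}. D $$ (i, j) * z $ j)"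
      using D that by (intro sum.mono_neutral_right) (auto simp: diagonal_mat_def)
    finally show ?thesis by simp
  qed
  then show ?thesis
    using D z by (auto simp: quad_form_def scalar_prod_def atLeast0LessThan power2_eq_square
        intro!: sum.cong)
qed

text \<open>A positive diagonal form is a positively weighted sum of squares, hence monotone in the
  absolute value of each coordinate. This is where diagonality of \<open>D\<close> matters.\<close>

lemma quad_form_mono:
  assumes D: "pos_diag_mat r D" and "q \<in> carrier_vec r" "p \<in> carrier_vec r"
    and le: "\<And>i. i < r \<Longrightarrow> \<bar>q $ i\<bar> \<le> \<bar>p $ i\<bar>"
  shows "quad_form D q \<le> quad_form D p"
  using assms
  by (auto simp: pos_diag_mat_def quad_form_diag less_imp_le abs_le_square_iff[symmetric]
      intro!: sum_mono mult_left_mono)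

text \<open>Moving \<open>transpose_mat C\<close> across the scalar product shows that the gap
  between the two sides is the positive-definite form evaluated at \<open>q\<close>.\<close>

lemma quad_form_mult_mat_vec_less:
  assumes D: "D \<in> carrier_mat r r" and C: "C \<in> carrier_mat r r"
    and pd: "pos_def_mat (D - transpose_mat C * D * C)"
    and q: "q \<in> carrier_vec r" "q \<noteq> 0\<^sub>v r"
  shows "quad_form D (C *\<^sub>v q) < quad_form D q"
proof -
  define E where "E = transpose_mat C * D * C"
  have E: "E \<in> carrier_mat r r"
    unfolding E_def using D C by auto
  have "E *\<^sub>v q = transpose_mat C *\<^sub>v (D *\<^sub>v (C *\<^sub>v q))"
    unfolding E_def using D C q by (simp add: assoc_mult_mat_vec[where n\<^sub>2 = r and n\<^sub>3 = r]
        mult_carrier_mat[of _ r r _ r])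
  moreover have "q \<bullet> (transpose_mat C *\<^sub>v (D *\<^sub>v (C *\<^sub>v q))) = (C *\<^sub>v q) \<bullet> (D *\<^sub>v (C *\<^sub>v q))"
    using D C q transpose_vec_mult_scalar[of C r r q "D *\<^sub>v (C *\<^sub>v q)"]
      comm_scalar_prod[of q r] comm_scalar_prod[of "C *\<^sub>v q" r] by simp
  moreover have "0 < q \<bullet> ((D - E) *\<^sub>v q)"
    using pd[folded E_def] E q unfolding pos_def_mat_def by auto
  moreover have "(D - E) *\<^sub>v q = D *\<^sub>v q - E *\<^sub>v q"
    using D E q by (intro minus_mult_distrib_mat_vec) auto
  moreover have "q \<bullet> (D *\<^sub>v q - E *\<^sub>v q) = q \<bullet> (D *\<^sub>v q) - q \<bullet> (E *\<^sub>v q)"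
    using D E q by (intro scalar_prod_minus_distrib[of _ r]) auto
  ultimately show ?thesis by (simp add: quad_form_def)
qed

section \<open>Decrease of the quadratic form along solutions\<close>

theorem theorem4:
  fixes n k :: nat and A :: "real mat" and S :: "real set" and \<phi> :: "nat \<Rightarrow> real \<Rightarrow> real"
  assumes "n \<ge> 2" and "k \<in> {1..n - 1}"
    and "A \<in> carrier_mat n n"
    and "DT_k_diagonally_stable n k A"
    and "0 \<in> interior S"
    and "\<forall>i < n. continuous_on S (\<phi> i)"
    and "\<forall>i < n. \<forall>s \<in> S. \<phi> i s = 0 \<longrightarrow> s = 0"
    and "k_content_preserving n k S \<phi>"
    and "\<forall>x \<in> vec_cube n S. A *\<^sub>v diag_map \<phi> x \<in> vec_cube n S"
  shows "(\<forall>as. length as = k \<and> set as \<subseteq> vec_cube n S \<longrightarrow>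
            (\<forall>j. wedge_solution n A \<phi> as (Suc j) =
                 compound k A *\<^sub>v wedge n (map (\<lambda>a. diag_map \<phi> (solution A \<phi> j a)) as))) \<and>
         (\<exists>D. pos_diag_mat (n choose k) D \<and>
            (\<forall>as. length as = k \<and> set as \<subseteq> vec_cube n S \<longrightarrow>
              (\<forall>j. let y = wedge_solution n A \<phi> as in
                   quad_form D (y (Suc j)) - quad_form D (y j) \<le> 0 \<and>
                   (quad_form D (y (Suc j)) - quad_form D (y j) = 0 \<longrightarrow>
                     y j = 0\<^sub>v (n choose k)))))"
proof -
  let ?C = "compound k A" and ?r = "n choose k"
  let ?q = "\<lambda>as j. wedge n (map (\<lambda>a. diag_map \<phi> (solution A \<phi> j a)) as)"
  \<comment> \<open>This \<open>D\<close> comes from \<open>A\<close> alone, so it serves all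
    initial vectors and all times.\<close>
  obtain D where D: "pos_diag_mat ?r D" and pd: "pos_def_mat (D - transpose_mat ?C * D * ?C)"
    using assms(4) by (auto simp: DT_k_diagonally_stable_def)
  have Dc: "D \<in> carrier_mat ?r ?r" using D by (simp add: pos_diag_mat_def)
  have C: "?C \<in> carrier_mat ?r ?r" using assms(3) by (auto simp: compound_def)
  \<comment> \<open>Invariance of the cube lets content preservation be applied at every time
    \<open>j\<close>, not only to the initial vectors.\<close>
  have cube: "solution A \<phi> j a \<in> vec_cube n S" if "a \<in> vec_cube n S" for j a
    using that assms(9) by (induction j) auto
  have step: "wedge_solution n A \<phi> as (Suc j) = ?C *\<^sub>v ?q as j"
    if "length as = k" "set as \<subseteq> vec_cube n S" for as j
  proof -
    have "set (map (\<lambda>a. diag_map \<phi> (solution A \<phi> j a)) as) \<subseteq> carrier_vec n"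
      using cube that by (auto simp: vec_cube_def diag_map_def)
    from wedge_mult_mat_vec[OF assms(3) this]
    have "wedge n (map (\<lambda>a. A *\<^sub>v diag_map \<phi> (solution A \<phi> j a)) as) = ?C *\<^sub>v ?q as j"
      using that by (simp add: comp_def)
    moreover have "map (solution A \<phi> (Suc j)) as =
        map (\<lambda>a. A *\<^sub>v diag_map \<phi> (solution A \<phi> j a)) as"
      by simp
    ultimately show ?thesis by (simp only: wedge_solution_def)
  qed
  moreover have "quad_form D (y (Suc j)) - quad_form D (y j) \<le> 0 \<and>
      (quad_form D (y (Suc j)) - quad_form D (y j) = 0 \<longrightarrow> y j = 0\<^sub>v ?r)"
    if as: "length as = k" "set as \<subseteq> vec_cube n S" and y: "y = wedge_solution n A \<phi> as"
    for as j y
  proof -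
    have yc: "y j \<in> carrier_vec ?r" and qc: "?q as j \<in> carrier_vec ?r"
      using wedge_carrier[of n "map (solution A \<phi> j) as"] as
        wedge_carrier[of n "map (\<lambda>a. diag_map \<phi> (solution A \<phi> j a)) as"]
      by (simp_all add: y wedge_solution_def)
    have "length (map (solution A \<phi> j) as) = k \<and> set (map (solution A \<phi> j) as) \<subseteq> vec_cube n S"
      using as cube by auto
    then have content: "(y j $ i = 0 \<longrightarrow> ?q as j $ i = 0) \<and>
        (y j $ i \<noteq> 0 \<longrightarrow> 0 < \<bar>?q as j $ i\<bar> \<and> \<bar>?q as j $ i\<bar> \<le> \<bar>y j $ i\<bar>)" if "i < ?r" for i
      using assms(8) that
      unfolding k_content_preserving_def Let_def y wedge_solution_def
      by (fastforce simp only: map_map comp_def)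
    have le: "quad_form D (?q as j) \<le> quad_form D (y j)"
      by (rule quad_form_mono[OF D qc yc]) (use content in fastforce)
    show ?thesis
    proof (cases "?q as j = 0\<^sub>v ?r")
      case True
      \<comment> \<open>A nonzero coordinate of \<open>y j\<close> would force the same coordinate
        of \<open>?q as j\<close> to be nonzero.\<close>
      then have y0: "y j = 0\<^sub>v ?r" using content yc by (intro eq_vecI) force+
      have "?C *\<^sub>v 0\<^sub>v ?r = 0\<^sub>v ?r" using C by (intro eq_vecI) auto
      then have "y (Suc j) = y j"
        using step[OF as, of j] True y0 by (simp add: y)
      then show ?thesis using y0 by simp
    next
      case False
      \<comment> \<open>Here the decrease under \<open>?C\<close> is strict and \<open>le\<close>
        carries it over to \<open>y j\<close>, so the equality case cannot occur.\<close>
      then show ?thesis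
        using quad_form_mult_mat_vec_less[OF Dc C pd qc False] le step[OF as, of j]
        by (simp add: y)
    qed
  qed
  ultimately show ?thesis using D by (auto simp: Let_def)
qed

end
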